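(* Let $G$ be a graph of order $n$ and let $k$ be a non-negative integer. Then $\mathrm{mis}_{\leq k}(G)\leq 3^{4k-n}4^{n-3k}$, with equality if and only if $G$ is the disjoint union of $k$ graphs, each of which is a copy of $K_3$ or of $K_4$.
   Context: All graphs are finite, simple and undirected. For a graph $G$, $\mathrm{mis}_{\leq k}(G)$ denotes the number of maximal independent sets $I$ of $G$ (independent sets not properly contained in another independent set) with $|I|\leq k$. *)

theory Defs
  imports Complex_Main "Graph_Theory.Kuratowski"
begin

text \<open>
  A finite simple undirected graph is a \<^typ>\<open>'a pair_pre_digraph\<close> satisfying
  \<^const>\<open>pair_graph\<close>: its arc set is a symmetric, irreflexive relation on its finite vertex set,
  an undirected edge being represented by its two orientations. The null graph is included.
\<close>

definition independent_set :: "'a pair_pre_digraph \<Rightarrow> 'a set \<Rightarrow> bool" where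
  "independent_set G I \<longleftrightarrow> I \<subseteq> pverts G \<and> (\<forall>u\<in>I. \<forall>v\<in>I. (u, v) \<notin> parcs G)"

definition maximal_independent_set :: "'a pair_pre_digraph \<Rightarrow> 'a set \<Rightarrow> bool" where
  "maximal_independent_set G I \<longleftrightarrow>
     independent_set G I \<and> \<not> (\<exists>J. independent_set G J \<and> I \<subset> J)"

definition mis_le :: "nat \<Rightarrow> 'a pair_pre_digraph \<Rightarrow> nat" where
  "mis_le k G = card {I. maximal_independent_set G I \<and> card I \<le> k}"

text \<open>
  The disjoint union is internal: the summands are subgraphs of \<open>G\<close> with pairwise disjoint
  vertex sets.
\<close>

definition is_disjoint_union ::
  "'a pair_pre_digraph \<Rightarrow> 'i set \<Rightarrow> ('i \<Rightarrow> 'a pair_pre_digraph) \<Rightarrow> bool" where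
  "is_disjoint_union G A H \<longleftrightarrow>
     (\<forall>i\<in>A. \<forall>j\<in>A. i \<noteq> j \<longrightarrow> pverts (H i) \<inter> pverts (H j) = {}) \<and>
     pverts G = (\<Union>i\<in>A. pverts (H i)) \<and>
     parcs G = (\<Union>i\<in>A. parcs (H i))"

end

theory Submission
  imports Defs
begin

text \<open>
  Let \<open>f k n = (81/64)^k (4/3)^n\<close> be the bound and let \<open>v\<close> have minimum degree, \<open>d\<close> being the size
  of its closed neighbourhood \<open>N[v]\<close>. Every maximal independent set meets \<open>N[v]\<close>, and those
  containing \<open>u\<close> correspond to those of \<open>G - N[u]\<close>, so by induction on \<open>k\<close> there are at most
  \<open>d f (k-1) (n-d)\<close> of them, which is at most \<open>f k n\<close> since \<open>d \<le> (81/64) (4/3)^d\<close>, with equality only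
  for \<open>d = 3\<close> and \<open>d = 4\<close>. If equality holds, then every \<open>u\<close> in \<open>N[v]\<close> has the same degree as \<open>v\<close>
  and \<open>G - N[u]\<close> is a union of \<open>k - 1\<close> cliques. Two non-adjacent members of \<open>N[v]\<close> would lie in a
  common maximal independent set, which has size \<open>k\<close> and is counted twice. Hence \<open>N[v]\<close> is a
  clique, and by regularity a component.
\<close>

section \<open>Numerical inequality and a strict union bound\<close>

lemma le_mis_factor:
  fixes d :: nat
  shows "real d \<le> 81/64 * (4/3)^d"
    and "real d = 81/64 * (4/3)^d \<Longrightarrow> d = 3 \<or> d = 4"
proof -
  have large: "real x < 81/64 * (4/3)^x" if "x \<ge> 5" for x :: nat
    using that
  proof (induction x rule: dec_induct)
    case base
    show ?case by (simp add: power_numeral_reduce)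
  next
    case (step x)
    \<comment> \<open>The right side grows by the factor 4/3, and \<open>x + 1 \<le> 4/3 * x\<close>
      once \<open>x \<ge> 3\<close>.\<close>
    then show ?case by simp
  qed
  consider "d = 0" | "d = 1" | "d = 2" | "d = 3" | "d = 4" | "d \<ge> 5" by linarith
  then have "real d \<le> 81/64 * (4/3)^d \<and> (real d = 81/64 * (4/3)^d \<longrightarrow> d = 3 \<or> d = 4)"
    by cases (use large[of d] in \<open>auto simp: power_numeral_reduce\<close>)
  then show "real d \<le> 81/64 * (4/3)^d" "real d = 81/64 * (4/3)^d \<Longrightarrow> d = 3 \<or> d = 4"
    by auto
qed

text \<open>An element of two of the sets is counted twice by the sum. In the equality case this
  excludes non-adjacent members of a closed neighbourhood.\<close>

lemma card_UN_less_sum: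
  assumes "finite S" "\<And>i. i \<in> S \<Longrightarrow> finite (A i)"
    and "i \<in> S" "j \<in> S" "i \<noteq> j" "x \<in> A i" "x \<in> A j"
  shows "card (\<Union>i\<in>S. A i) < (\<Sum>i\<in>S. card (A i))"
proof -
  let ?U = "\<Union>l\<in>S - {i}. A l"
  have fin: "finite (A i)" "finite ?U" using assms by auto
  have "x \<in> A i \<inter> ?U" using assms by auto
  then have "card (A i \<inter> ?U) > 0" using fin by (auto simp: card_gt_0_iff)
  then have "card (A i \<union> ?U) < card (A i) + card ?U"
    using card_Un_Int[OF fin] by linarith
  also have "card ?U \<le> (\<Sum>l\<in>S - {i}. card (A l))"
    using assms(1) by (intro card_UN_le) auto
  also have "card (A i) + (\<Sum>l\<in>S - {i}. card (A l)) = (\<Sum>l\<in>S. card (A l))"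
    using assms(1,3) by (simp add: sum.remove)
  also have "A i \<union> ?U = (\<Union>l\<in>S. A l)" using assms(3) by auto
  finally show ?thesis by simp
qed

section \<open>Induced subgraphs and their maximal independent sets\<close>

definition closed_nbhd :: "('a \<times> 'a) set \<Rightarrow> 'a set \<Rightarrow> 'a \<Rightarrow> 'a set" where
  "closed_nbhd E W u = {w\<in>W. w = u \<or> (u, w) \<in> E}"

text \<open>The edge relation stays fixed and only \<open>W\<close> shrinks when vertices are
  deleted. Maximality is put as domination, which passes easily to \<open>W\<close> without a closed
  neighbourhood.\<close>

definition mis_on :: "('a \<times> 'a) set \<Rightarrow> 'a set \<Rightarrow> 'a set \<Rightarrow> bool" where
  "mis_on E W I \<longleftrightarrow> I \<subseteq> W \<and> (\<forall>u\<in>I. \<forall>v\<in>I. (u, v) \<notin> E) \<and> (\<forall>w\<in>W - I. \<exists>u\<in>I. (u, w) \<in> E)"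

definition mis_family :: "('a \<times> 'a) set \<Rightarrow> nat \<Rightarrow> 'a set \<Rightarrow> 'a set set" where
  "mis_family E k W = {I. mis_on E W I \<and> card I \<le> k}"

text \<open>Adding one component at a time mirrors the deletion of a closed neighbourhood. Edges are
  excluded in the direction from \<open>C\<close> to \<open>W\<close>; symmetry of \<open>E\<close>
  gives the other.\<close>

inductive clique_union :: "('a \<times> 'a) set \<Rightarrow> nat \<Rightarrow> 'a set \<Rightarrow> bool" for E where
  empty: "clique_union E 0 {}"
| add: "clique_union E k W \<Longrightarrow> C \<inter> W = {} \<Longrightarrow> card C = 3 \<or> card C = 4 \<Longrightarrow>
    (\<And>x y. x \<in> C \<Longrightarrow> y \<in> C \<Longrightarrow> x \<noteq> y \<Longrightarrow> (x, y) \<in> E) \<Longrightarrow>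
    (\<And>x y. x \<in> C \<Longrightarrow> y \<in> W \<Longrightarrow> (x, y) \<notin> E) \<Longrightarrow> clique_union E (Suc k) (C \<union> W)"

lemma closed_nbhd_subset: "closed_nbhd E W u \<subseteq> W"
  by (auto simp: closed_nbhd_def)

lemma self_in_closed_nbhd: "u \<in> W \<Longrightarrow> u \<in> closed_nbhd E W u"
  by (auto simp: closed_nbhd_def)

lemma finite_closed_nbhd: "finite W \<Longrightarrow> finite (closed_nbhd E W u)"
  by (auto simp: closed_nbhd_def)

lemma finite_mis_family: "finite W \<Longrightarrow> finite (mis_family E k W)"
  by (rule finite_subset[of _ "Pow W"]) (auto simp: mis_family_def mis_on_def)

lemma clique_union_finite: "clique_union E k W \<Longrightarrow> finite W"
  by (induction rule: clique_union.induct) (auto intro: card_ge_0_finite)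

lemma mis_family_empty: "mis_family E k {} = {{}}"
  by (auto simp: mis_family_def mis_on_def)

section \<open>Deleting a closed neighbourhood\<close>

context
  fixes E :: "('a \<times> 'a) set"
  assumes sym: "sym E" and irr: "irrefl E"
begin

text \<open>Independence keeps \<open>I - {u}\<close> off the closed neighbourhood of
  \<open>u\<close>, and a vertex outside it is not adjacent to \<open>u\<close>, so another member
  of \<open>I\<close> dominates it.\<close>

lemma mis_on_remove:
  assumes "mis_on E W I" "u \<in> I"
  shows "mis_on E (W - closed_nbhd E W u) (I - {u})"
  using assms unfolding mis_on_def closed_nbhd_def by blast

lemma mis_on_insert:
  assumes "mis_on E (W - closed_nbhd E W u) J" "u \<in> W"
  shows "mis_on E W (insert u J)"
proof -
  have J: "J \<subseteq> W" "\<And>x y. x \<in> J \<Longrightarrow> y \<in> J \<Longrightarrow> (x, y) \<notin> E" "\<And>x. x \<in> J \<Longrightarrow> (u, x) \<notin> E"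
    and dom: "\<And>w. w \<in> W \<Longrightarrow> w \<notin> closed_nbhd E W u \<Longrightarrow> w \<notin> J \<Longrightarrow> \<exists>x\<in>J. (x, w) \<in> E"
    using assms(1) by (auto simp: mis_on_def closed_nbhd_def)
  have "(x, u) \<notin> E" if "x \<in> J" for x using J(3)[OF that] symD[OF sym] by blast
  moreover have "(u, u) \<notin> E" using irr by (simp add: irrefl_def)
  \<comment> \<open>Vertices of the closed neighbourhood are dominated by \<open>u\<close>, all
    others by \<open>J\<close>.\<close>
  moreover have "\<exists>x\<in>insert u J. (x, w) \<in> E" if "w \<in> W - insert u J" for w
    using dom[of w] that by (cases "w \<in> closed_nbhd E W u") (auto simp: closed_nbhd_def)
  ultimately show ?thesis using J assms(2) by (simp add: mis_on_def)
qed

lemma mis_on_notin: "mis_on E (W - closed_nbhd E W u) J \<Longrightarrow> u \<notin> J"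
  unfolding mis_on_def closed_nbhd_def by blast

text \<open>Greedy construction: choose a vertex, delete its closed neighbourhood and
  continue.\<close>

lemma mis_on_exists: "finite W \<Longrightarrow> \<exists>I. mis_on E W I"
proof (induction "card W" arbitrary: W rule: less_induct)
  case less
  show ?case
  proof (cases "W = {}")
    case True
    then show ?thesis by (auto simp: mis_on_def)
  next
    case False
    then obtain u where u: "u \<in> W" by auto
    have "card (W - closed_nbhd E W u) < card W"
      using u less.prems self_in_closed_nbhd[OF u, of E] by (intro psubset_card_mono) auto
    then obtain J where "mis_on E (W - closed_nbhd E W u) J"
      using less.hyps less.prems by blast
    then show ?thesis using mis_on_insert u by blast
  qed
qed

lemma mis_on_exists_containing:
  assumes "finite W" "u \<in> W"
  shows "\<exists>I. mis_on E W I \<and> u \<in> I"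
  using mis_on_exists[of "W - closed_nbhd E W u"] mis_on_insert assms by blast

text \<open>Deleting and inserting \<open>u\<close> are mutually inverse and change the size by
  exactly one, which accounts for the shift from \<open>Suc k\<close> to \<open>k\<close>.\<close>

lemma card_mis_family_containing:
  assumes "finite W" "u \<in> W"
  shows "card {I \<in> mis_family E (Suc k) W. u \<in> I} = card (mis_family E k (W - closed_nbhd E W u))"
proof (rule bij_betw_same_card[where f = "\<lambda>I. I - {u}"],
    rule bij_betw_byWitness[where f' = "insert u"])
  \<comment> \<open>Finiteness matters for the shift since \<open>card\<close> is 0 on infinite
    sets.\<close>
  have fin: "finite I" if "mis_on E W I" for I
    using that assms(1) finite_subset unfolding mis_on_def by blast
  have fin': "finite I" if "mis_on E (W - closed_nbhd E W u) I" for I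
    using that assms(1) finite_subset[of I W] unfolding mis_on_def by blast
  show "\<forall>I\<in>{I \<in> mis_family E (Suc k) W. u \<in> I}. insert u (I - {u}) = I" by auto
  show "\<forall>J\<in>mis_family E k (W - closed_nbhd E W u). insert u J - {u} = J"
    using mis_on_notin by (auto simp: mis_family_def)
  show "(\<lambda>I. I - {u}) ` {I \<in> mis_family E (Suc k) W. u \<in> I}
      \<subseteq> mis_family E k (W - closed_nbhd E W u)"
    by (auto simp: mis_family_def mis_on_remove fin)
  show "insert u ` mis_family E k (W - closed_nbhd E W u)
      \<subseteq> {I \<in> mis_family E (Suc k) W. u \<in> I}"
    using assms(2) by (auto simp: mis_family_def mis_on_insert mis_on_notin fin')
qed

text \<open>If \<open>v\<close> is not in \<open>I\<close>, domination gives a neighbour of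
  \<open>v\<close> in \<open>I\<close>. This lets one closed neighbourhood index a cover of the
  whole family.\<close>

lemma mis_on_meets_closed_nbhd:
  assumes "mis_on E W I" "v \<in> W"
  shows "\<exists>u\<in>closed_nbhd E W v. u \<in> I"
  using assms sym unfolding mis_on_def closed_nbhd_def by (blast dest: symD)

lemma mis_family_eq_UN:
  assumes "v \<in> W"
  shows "mis_family E k W = (\<Union>u\<in>closed_nbhd E W v. {I \<in> mis_family E k W. u \<in> I})"
  using mis_on_meets_closed_nbhd[OF _ assms] by (auto simp: mis_family_def)

section \<open>Disjoint unions of triangles and 4-cliques attain the bound\<close>

lemma closed_nbhd_clique_component:
  assumes "u \<in> C" "\<And>x y. x \<in> C \<Longrightarrow> y \<in> C \<Longrightarrow> x \<noteq> y \<Longrightarrow> (x, y) \<in> E"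
    and "\<And>x y. x \<in> C \<Longrightarrow> y \<in> W \<Longrightarrow> (x, y) \<notin> E"
  shows "closed_nbhd E (C \<union> W) u = C"
  using assms unfolding closed_nbhd_def by blast

text \<open>Exactly one vertex is chosen from each of the \<open>k\<close> cliques. In the equality
  case this guarantees that the doubly counted set is small enough to be counted.\<close>

lemma card_mis_on_clique_union:
  assumes "clique_union E k W" "mis_on E W I"
  shows "card I = k"
  using assms
proof (induction arbitrary: I rule: clique_union.induct)
  case empty
  then show ?case by (auto simp: mis_on_def)
next
  case (add k W C)
  from add.hyps(3) obtain v where v: "v \<in> C" by fastforce
  have N: "closed_nbhd E (C \<union> W) u = C" if "u \<in> C" for u
    by (rule closed_nbhd_clique_component) (use add.hyps that in auto)
  obtain u where u: "u \<in> C" "u \<in> I"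
    using mis_on_meets_closed_nbhd[OF add.prems, of v] N[OF v] v by auto
  have "C \<union> W - C = W" using add.hyps(2) by auto
  then have "mis_on E W (I - {u})"
    using mis_on_remove[OF add.prems u(2)] N[OF u(1)] by simp
  then have "card (I - {u}) = k" by (rule add.IH)
  moreover have "finite I"
    using add.prems clique_union_finite[OF clique_union.add[OF add.hyps]]
    by (meson finite_subset mis_on_def)
  ultimately show ?case using u(2) card_Suc_Diff1 by metis
qed

text \<open>The choices in the cliques are independent, and a clique \<open>C\<close> of size 3 or 4
  contributes exactly the factor \<open>81/64 * (4/3)^card C\<close>.\<close>

lemma card_mis_family_clique_union:
  assumes "clique_union E k W"
  shows "real (card (mis_family E k W)) = (81/64)^k * (4/3)^card W"
  using assms
proof (induction rule: clique_union.induct)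
  case empty
  then show ?case by (simp add: mis_family_empty)
next
  case (add k W C)
  from add.hyps(3) obtain v where v: "v \<in> C" by fastforce
  have fin: "finite (C \<union> W)"
    by (rule clique_union_finite[OF clique_union.add[OF add.hyps]])
  have N: "closed_nbhd E (C \<union> W) u = C" if "u \<in> C" for u
    by (rule closed_nbhd_clique_component) (use add.hyps that in auto)
  have CW: "C \<union> W - C = W" using add.hyps(2) by auto
  let ?A = "\<lambda>u. {I \<in> mis_family E (Suc k) (C \<union> W). u \<in> I}"
  have "mis_family E (Suc k) (C \<union> W) = (\<Union>u\<in>C. ?A u)"
    using mis_family_eq_UN[of v "C \<union> W" "Suc k"] N[OF v] v by simp
  also have "card \<dots> = (\<Sum>u\<in>C. card (?A u))"
  proof (rule card_UN_disjoint)
    show "\<forall>i\<in>C. \<forall>j\<in>C. i \<noteq> j \<longrightarrow> ?A i \<inter> ?A j = {}"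
      \<comment> \<open>Distinct vertices of a clique never share an independent set.\<close>
      unfolding mis_family_def mis_on_def using add.hyps(4) by blast
  qed (use fin finite_mis_family[OF fin] in auto)
  also have "\<dots> = (\<Sum>u\<in>C. card (mis_family E k W))"
    using card_mis_family_containing[OF fin] N CW by (intro sum.cong) auto
  finally have "real (card (mis_family E (Suc k) (C \<union> W)))
      = real (card C) * ((81/64)^k * (4/3)^card W)"
    using add.IH by simp
  also have "real (card C) = 81/64 * (4/3)^card C"
    using add.hyps(3) by (auto simp: power_numeral_reduce)
  finally show ?case
    using card_Un_disjoint[of C W] fin add.hyps(2) by (simp add: power_add)
qed

section \<open>The upper bound and its equality case\<close>

lemma clique_unionI_closed_nbhd:
  assumes "finite W" "v \<in> W"
    and size: "card (closed_nbhd E W v) = 3 \<or> card (closed_nbhd E W v) = 4"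
    and regular: "\<And>u. u \<in> closed_nbhd E W v \<Longrightarrow>
        card (closed_nbhd E W u) = card (closed_nbhd E W v)"
    and clique: "\<And>u w. u \<in> closed_nbhd E W v \<Longrightarrow> w \<in> closed_nbhd E W v \<Longrightarrow> u \<noteq> w \<Longrightarrow> (u, w) \<in> E"
    and rest: "clique_union E k (W - closed_nbhd E W v)"
  shows "clique_union E (Suc k) W"
proof -
  let ?C = "closed_nbhd E W v"
  \<comment> \<open>The neighbourhood of \<open>u\<close> contains the clique and has the same size,
    so it coincides with it and no edge leaves \<open>?C\<close>.\<close>
  have eq: "closed_nbhd E W u = ?C" if "u \<in> ?C" for u
  proof (rule card_subset_eq[symmetric])
    show "?C \<subseteq> closed_nbhd E W u"
      using clique[OF that] closed_nbhd_subset[of E W v] by (auto simp: closed_nbhd_def)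
  qed (use assms(1) regular[OF that] finite_closed_nbhd in auto)
  have "(x, y) \<notin> E" if "x \<in> ?C" "y \<in> W - ?C" for x y
    using eq[OF that(1)] that(2) by (auto simp: closed_nbhd_def)
  then have "clique_union E (Suc k) (?C \<union> (W - ?C))"
    using size clique by (intro clique_union.add rest) auto
  moreover have "?C \<union> (W - ?C) = W" using closed_nbhd_subset[of E W v] by auto
  ultimately show ?thesis by simp
qed

text \<open>Both claims go through the induction together: equality for the whole family forces
  equality for each smaller one, whose structure then comes from the induction hypothesis.\<close>

lemma card_mis_family_le:
  assumes "finite W"
  shows "real (card (mis_family E k W)) \<le> (81/64)^k * (4/3)^card W \<and>
    (real (card (mis_family E k W)) = (81/64)^k * (4/3)^card W \<longrightarrow> clique_union E k W)"
  using assms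
proof (induction k arbitrary: W)
  case 0
  show ?case
  proof (cases "W = {}")
    case True
    then show ?thesis by (simp add: mis_family_empty clique_union.empty)
  next
    case False
    \<comment> \<open>Only the empty set has size 0, and it dominates no vertex, so the count is 0
      against a positive bound.\<close>
    have "mis_family E 0 W = {}"
    proof -
      have "\<not> mis_on E W {}" using False by (auto simp: mis_on_def)
      then show ?thesis
        using finite_subset[OF _ 0] by (auto simp: mis_family_def) (auto simp: mis_on_def)
    qed
    then show ?thesis by simp
  qed
next
  case (Suc k)
  show ?case
  proof (cases "W = {}")
    case True
    \<comment> \<open>The count is 1, so the equality claim is vacuous.\<close>
    have "(1::real) < (81/64)^Suc k" by (rule one_less_power) auto
    then show ?thesis using True by (simp add: mis_family_empty)
  next
    case False
    let ?N = "closed_nbhd E W"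
    obtain v where v: "v \<in> W" and v_min: "\<And>u. u \<in> W \<Longrightarrow> card (?N v) \<le> card (?N u)"
      using ex_min_if_finite[of "(\<lambda>u. card (?N u)) ` W"] False Suc.prems
      by (metis (no_types, lifting) finite_imageI image_iff image_is_empty not_less)
    define d where "d = card (?N v)"
    \<comment> \<open>\<open>F\<close> is the bound for \<open>k\<close> on all of \<open>W\<close>:
      deleting \<open>?N u\<close> divides it by \<open>(4/3)^card (?N u)\<close>, and the target is
      \<open>81/64 * F\<close>.\<close>
    define F :: real where "F = (81/64)^k * (4/3)^card W"
    have F: "F > 0" by (simp add: F_def)
    let ?A = "\<lambda>u. {I \<in> mis_family E (Suc k) W. u \<in> I}"
    let ?a = "\<lambda>u. real (card (?A u))"
    have finN: "finite (?N u)" for u using Suc.prems by (rule finite_closed_nbhd)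
    have NW: "u \<in> W" if "u \<in> ?N v" for u using that closed_nbhd_subset[of E W v] by auto
    have finA: "finite (?A u)" for u using finite_mis_family[OF Suc.prems] by simp
    have bound: "(81/64)^k * (4/3)^card (W - ?N u) = F / (4/3)^card (?N u)" for u
    proof -
      have "card (W - ?N u) + card (?N u) = card W"
        using card_Un_disjoint[of "W - ?N u" "?N u"] closed_nbhd_subset[of E W u] finN Suc.prems
        by (simp add: card_Diff_subset card_mono)
      then have "(4/3::real)^card W = (4/3)^card (W - ?N u) * (4/3)^card (?N u)"
        by (metis power_add)
      then show ?thesis by (simp add: F_def)
    qed
    have a_le: "?a u \<le> F / (4/3)^card (?N u)"
      and a_eq: "?a u = F / (4/3)^card (?N u) \<Longrightarrow> clique_union E k (W - ?N u)" if "u \<in> ?N v" for u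
      using Suc.IH[of "W - ?N u"] Suc.prems bound[of u]
        card_mis_family_containing[OF Suc.prems NW[OF that], of k] by auto
    \<comment> \<open>By minimality of \<open>d\<close>, every other deletion leaves at most as
      large a bound.\<close>
    have b_le: "F / (4/3)^card (?N u) \<le> F / (4/3)^d" if "u \<in> ?N v" for u
      using v_min[OF NW[OF that]] F
      by (intro divide_left_mono) (auto simp: d_def)
    have U: "mis_family E (Suc k) W = (\<Union>u\<in>?N v. ?A u)"
      by (rule mis_family_eq_UN[OF v])
    have le1: "real (card (mis_family E (Suc k) W)) \<le> (\<Sum>u\<in>?N v. ?a u)"
      unfolding of_nat_sum[symmetric] of_nat_le_iff by (subst U) (rule card_UN_le[OF finN])
    have le2: "(\<Sum>u\<in>?N v. ?a u) \<le> (\<Sum>u\<in>?N v. F / (4/3)^d)"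
      using a_le b_le by (intro sum_mono) (meson order_trans)
    have sum_eq: "(\<Sum>u\<in>?N v. F / (4/3)^d) = real d * (F / (4/3)^d)"
      by (simp add: d_def)
    have le3: "real d * (F / (4/3)^d) \<le> 81/64 * F"
      using mult_right_mono[OF le_mis_factor(1)[of d], of "F / (4/3)^d"] F by simp
    have goal: "(81/64)^Suc k * (4/3)^card W = 81/64 * F" by (simp add: F_def)
    have "clique_union E (Suc k) W" if eq: "real (card (mis_family E (Suc k) W)) = 81/64 * F"
    proof -
      \<comment> \<open>Equality at both ends turns \<open>le1\<close>, \<open>le2\<close> and
        \<open>le3\<close> into equalities.\<close>
      have "real d * (F / (4/3)^d) = 81/64 * F" using le1 le2 le3 sum_eq eq by linarith
      then have "real d = 81/64 * (4/3)^d" using F by (simp add: field_simps)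
      then have d: "d = 3 \<or> d = 4" by (rule le_mis_factor(2))
      have sum2: "(\<Sum>u\<in>?N v. ?a u) = (\<Sum>u\<in>?N v. F / (4/3)^d)"
        using le1 le2 le3 sum_eq eq by linarith
      \<comment> \<open>Termwise inequalities with equal sums are equalities.\<close>
      have a_tight: "?a u = F / (4/3)^d" if "u \<in> ?N v" for u
        using sum_mono_inv[OF sum2 _ that finN] a_le b_le by (meson order_trans)
      have rest: "clique_union E k (W - ?N u)" if "u \<in> ?N v" for u
        using a_eq[OF that] a_le[OF that] b_le[OF that] a_tight[OF that] by linarith
      have regular: "card (?N u) = card (?N v)" if "u \<in> ?N v" for u
      proof -
        have "F / (4/3)^card (?N u) = F / (4/3)^d"
          using a_le[OF that] b_le[OF that] a_tight[OF that] by linarith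
        then have "(4/3::real)^card (?N u) = (4/3)^d" using F by (simp add: field_simps)
        then show ?thesis by (simp add: d_def)
      qed
      have clique: "(u, w) \<in> E" if uw: "u \<in> ?N v" "w \<in> ?N v" "u \<noteq> w" for u w
      proof (rule ccontr)
        assume "(u, w) \<notin> E"
        then have w: "w \<in> W - ?N u" using uw NW[OF uw(2)] by (auto simp: closed_nbhd_def)
        then obtain J where J: "mis_on E (W - ?N u) J" "w \<in> J"
          using mis_on_exists_containing[of "W - ?N u" w] Suc.prems by auto
        have "card J = k" using card_mis_on_clique_union[OF rest[OF uw(1)] J(1)] .
        then have "card (insert u J) \<le> Suc k" by (cases "finite J") (auto simp: card_insert_if)
        then have "insert u J \<in> mis_family E (Suc k) W"
          using mis_on_insert[OF J(1) NW[OF uw(1)]] by (simp add: mis_family_def)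
        \<comment> \<open>The set \<open>insert u J\<close> contains both \<open>u\<close> and
          \<open>w\<close>, so the union bound is strict, against \<open>eq\<close>.\<close>
        then have "card (\<Union>u\<in>?N v. ?A u) < (\<Sum>u\<in>?N v. card (?A u))"
          using J(2) uw finN finA
          by (intro card_UN_less_sum[where i = u and j = w and x = "insert u J"]) auto
        then have "real (card (mis_family E (Suc k) W)) < (\<Sum>u\<in>?N v. ?a u)"
          unfolding of_nat_sum[symmetric] of_nat_less_iff U[symmetric] .
        then show False using le2 le3 sum_eq eq by linarith
      qed
      show ?thesis
        using Suc.prems v d regular clique rest[OF self_in_closed_nbhd[OF v]]
        by (intro clique_unionI_closed_nbhd[of W v k]) (auto simp: d_def)
    qed
    moreover have "real (card (mis_family E (Suc k) W)) \<le> 81/64 * F"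
      using le1 le2 le3 sum_eq by linarith
    ultimately show ?thesis unfolding goal by blast
  qed
qed

end

section \<open>Translation to graphs and disjoint unions\<close>

lemma maximal_independent_set_iff_mis_on:
  assumes "sym (parcs G)" "irrefl (parcs G)"
  shows "maximal_independent_set G I \<longleftrightarrow> mis_on (parcs G) (pverts G) I"
proof
  assume max: "maximal_independent_set G I"
  then have I: "independent_set G I" by (simp add: maximal_independent_set_def)
  have "\<exists>u\<in>I. (u, w) \<in> parcs G" if w: "w \<in> pverts G - I" for w
  proof (rule ccontr)
    \<comment> \<open>An undominated vertex could be added, against maximality.\<close>
    assume "\<not> (\<exists>u\<in>I. (u, w) \<in> parcs G)"
    then have "independent_set G (insert w I)"
      using I w assms by (auto simp: independent_set_def irrefl_def dest: symD)
    then show False using max w by (auto simp: maximal_independent_set_def)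
  qed
  then show "mis_on (parcs G) (pverts G) I"
    using I by (auto simp: mis_on_def independent_set_def)
next
  assume "mis_on (parcs G) (pverts G) I"
  then show "maximal_independent_set G I"
    unfolding mis_on_def maximal_independent_set_def independent_set_def by blast
qed

text \<open>\<open>E\<close> may have pairs outside \<open>W\<close>, so it is restricted to form a
  graph. Each added clique becomes the summand with the next index.\<close>

lemma clique_union_imp_disjoint_union:
  assumes "clique_union E k W" "irrefl E" "sym E"
  shows "\<exists>H :: nat \<Rightarrow> 'a pair_pre_digraph.
    is_disjoint_union \<lparr>pverts = W, parcs = E \<inter> W \<times> W\<rparr> {..<k} H \<and>
    (\<forall>i<k. complete_digraph 3 (with_proj (H i)) \<or> complete_digraph 4 (with_proj (H i)))"
  using assms
proof (induction rule: clique_union.induct)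
  case empty
  then show ?case by (auto simp: is_disjoint_union_def)
next
  case (add k W C)
  then obtain H :: "nat \<Rightarrow> 'a pair_pre_digraph" where
    H: "is_disjoint_union \<lparr>pverts = W, parcs = E \<inter> W \<times> W\<rparr> {..<k} H"
    and K: "\<And>i. i < k \<Longrightarrow> complete_digraph 3 (with_proj (H i)) \<or> complete_digraph 4 (with_proj (H i))"
    by blast
  let ?K = "\<lparr>pverts = C, parcs = {(x, y). x \<in> C \<and> y \<in> C \<and> x \<noteq> y}\<rparr>"
  have K': "complete_digraph 3 (with_proj ?K) \<or> complete_digraph 4 (with_proj ?K)"
    using add.hyps(3) by (auto simp: complete_digraph_pair_def intro: card_ge_0_finite)
  have V: "W = (\<Union>i<k. pverts (H i))" and A: "E \<inter> W \<times> W = (\<Union>i<k. parcs (H i))"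
    and D: "\<And>i j. i < k \<Longrightarrow> j < k \<Longrightarrow> i \<noteq> j \<Longrightarrow> pverts (H i) \<inter> pverts (H j) = {}"
    using H by (auto simp: is_disjoint_union_def)
  have CH: "x \<notin> pverts (H i)" if "i < k" "x \<in> C" for i x using add.hyps(2) V that by auto
  have "E \<inter> (C \<union> W) \<times> (C \<union> W) = parcs ?K \<union> E \<inter> W \<times> W"
    using add.hyps(4,5) add.prems by (auto simp: irrefl_def dest: symD)
  then have "E \<inter> (C \<union> W) \<times> (C \<union> W) = parcs ?K \<union> (\<Union>i<k. parcs (H i))" using A by simp
  moreover have "C \<union> W = C \<union> (\<Union>i<k. pverts (H i))" using V by simp
  ultimately have "is_disjoint_union \<lparr>pverts = C \<union> W, parcs = E \<inter> (C \<union> W) \<times> (C \<union> W)\<rparr> {..<Suc k} (H(k := ?K))"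
    using CH D unfolding is_disjoint_union_def disjoint_iff
    by (auto simp: lessThan_Suc less_Suc_eq)
  moreover have "\<forall>i<Suc k. complete_digraph 3 (with_proj ((H(k := ?K)) i)) \<or>
      complete_digraph 4 (with_proj ((H(k := ?K)) i))"
    using K K' by (auto simp: less_Suc_eq)
  ultimately show ?case by blast
qed

text \<open>The first \<open>m\<close> summands are assembled by induction on \<open>m\<close>. An
  edge lies within a single summand, so disjointness excludes edges between summands.\<close>

lemma disjoint_union_imp_clique_union:
  assumes H: "is_disjoint_union G {..<k} H"
    and K: "\<And>i. i < k \<Longrightarrow> complete_digraph 3 (with_proj (H i)) \<or> complete_digraph 4 (with_proj (H i))"
  shows "clique_union (parcs G) k (pverts G)"
proof -
  have A: "parcs G = (\<Union>i<k. parcs (H i))"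
    and D: "\<And>i j. i < k \<Longrightarrow> j < k \<Longrightarrow> i \<noteq> j \<Longrightarrow> pverts (H i) \<inter> pverts (H j) = {}"
    using H by (auto simp: is_disjoint_union_def)
  have P: "parcs (H i) = {(x, y). x \<in> pverts (H i) \<and> y \<in> pverts (H i) \<and> x \<noteq> y}" if "i < k" for i
    using K[OF that] by (auto simp: complete_digraph_pair_def)
  have "clique_union (parcs G) m (\<Union>i<m. pverts (H i))" if "m \<le> k" for m
    using that
  proof (induction m)
    case 0
    then show ?case by (simp add: clique_union.empty)
  next
    case (Suc m)
    then have m: "m < k" by simp
    have "clique_union (parcs G) (Suc m) (pverts (H m) \<union> (\<Union>i<m. pverts (H i)))"
    proof (rule clique_union.add)
      have "pverts (H m) \<inter> pverts (H i) = {}" if "i < m" for i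
        using D[of m i] m that by auto
      then show "pverts (H m) \<inter> (\<Union>i<m. pverts (H i)) = {}" by blast
      show "card (pverts (H m)) = 3 \<or> card (pverts (H m)) = 4"
        using K[OF m] by (auto simp: complete_digraph_pair_def)
      show "(x, y) \<in> parcs G" if "x \<in> pverts (H m)" "y \<in> pverts (H m)" "x \<noteq> y" for x y
        using that A P[OF m] m by auto
      show "(x, y) \<notin> parcs G" if xy: "x \<in> pverts (H m)" "y \<in> (\<Union>i<m. pverts (H i))" for x y
      proof
        assume "(x, y) \<in> parcs G"
        then obtain i where i: "i < k" "x \<in> pverts (H i)" "y \<in> pverts (H i)"
          using A P by auto
        obtain j where j: "j < m" "y \<in> pverts (H j)" using xy by auto
        have "i = m" using D[OF i(1) m] i xy by auto
        moreover have "i = j" using D[OF i(1), of j] i j m by auto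
        ultimately show False using j by simp
      qed
    qed (use Suc in simp)
    then show ?case by (simp add: lessThan_Suc)
  qed
  then show ?thesis using H by (simp add: is_disjoint_union_def)
qed

theorem theorem1:
  fixes G :: "'a pair_pre_digraph" and n k :: nat
  assumes "pair_graph G" and "card (pverts G) = n"
  shows "real (mis_le k G) \<le> 3 powi (4 * int k - int n) * 4 powi (int n - 3 * int k) \<and>
    (real (mis_le k G) = 3 powi (4 * int k - int n) * 4 powi (int n - 3 * int k) \<longleftrightarrow>
      (\<exists>H :: nat \<Rightarrow> 'a pair_pre_digraph. is_disjoint_union G {..<k} H \<and>
        (\<forall>i<k. complete_digraph 3 (with_proj (H i)) \<or> complete_digraph 4 (with_proj (H i)))))"
proof -
  interpret pair_graph G by fact
  have sym: "sym (parcs G)" using sym_arcs by (simp add: symmetric_def sym_def)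
  have irr: "irrefl (parcs G)" using no_loops by (fastforce simp: irrefl_def)
  \<comment> \<open>Arcs join vertices of \<open>G\<close>, so the restriction made in the
    translation returns \<open>G\<close> itself.\<close>
  have "parcs G \<inter> pverts G \<times> pverts G = parcs G"
    using in_arcsD1 in_arcsD2 by auto
  then have induced: "\<lparr>pverts = pverts G, parcs = parcs G \<inter> pverts G \<times> pverts G\<rparr> = G" by simp
  have "mis_le k G = card (mis_family (parcs G) k (pverts G))"
    by (simp add: mis_le_def mis_family_def maximal_independent_set_iff_mis_on[OF sym irr])
  \<comment> \<open>Powers are regrouped by \<open>k\<close> and \<open>n\<close>, using
    \<open>3^4 = 81\<close> and \<open>4^3 = 64\<close>.\<close>
  moreover have "3 powi (4 * int k - int n) * 4 powi (int n - 3 * int k) = (81/64)^k * (4/3::real)^n"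
  proof -
    have "(3::real) powi (4 * int k - int n) = 81^k / 3^n"
      using power_int_diff[of "3::real" "int (4 * k)" "int n"] by (simp add: power_int_mult)
    moreover have "(4::real) powi (int n - 3 * int k) = 4^n / 64^k"
      using power_int_diff[of "4::real" "int n" "int (3 * k)"] by (simp add: power_int_mult)
    ultimately show ?thesis by (simp add: power_divide)
  qed
  moreover have "clique_union (parcs G) k (pverts G) \<longleftrightarrow>
      (\<exists>H :: nat \<Rightarrow> 'a pair_pre_digraph. is_disjoint_union G {..<k} H \<and>
        (\<forall>i<k. complete_digraph 3 (with_proj (H i)) \<or> complete_digraph 4 (with_proj (H i))))"
    using clique_union_imp_disjoint_union[OF _ irr sym, of k "pverts G", unfolded induced]
      disjoint_union_imp_clique_union[of G k] by blast
  ultimately show ?thesis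
    using card_mis_family_le[OF sym irr, of "pverts G" k]
      card_mis_family_clique_union[OF sym irr, of k "pverts G"] assms(2) finite_verts by auto
qed

end
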